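(* Let $\mathcal{A}$ be a monoid of games that is outcome-stable, hereditary, integer-invertible, and has Property X. Then $\mathcal{P}(\mathcal{A})$, the set of strictly $\mathscr{P}$-free elements of $\mathcal{A}$, is a monoid (in particular it is closed under disjunctive sum).
   Context: Games are short misère-play game forms, possibly augmented in Siegel's sense: any subposition may additionally carry a Left and/or Right tombstone among its options; if a Left (Right) tombstone is present, Left (Right) is deemed to win moving first from there. A game is Left end-like if it has no Left options or has a Left tombstone (Right end-like symmetrically). Outcomes $o(G)\in\{\mathscr{L},\mathscr{N},\mathscr{P},\mathscr{R}\}$; $o_L(G)$, $o_R(G)$ denote the outcome with Left, resp. Right, moving first. $+$ is disjunctive sum, $\overline{G}$ the conjugate, $0=\{\cdot\mid\cdot\}$; for $n\ge1$ the integer $n$ is $\{n-1\mid\cdot\}$ and $\overline{n}$ its conjugate; for $k\in\mathbb{Z}$, $G+k$ means $G+\overline{-k}$ if $k<0$. A subposition of $G$ is any game reachable by a possibly empty, not necessarily alternating, sequence of moves. A game is strictly $\mathscr{P}$-free if no subposition has outcome $\mathscr{P}$; $\mathcal{P}(\mathcal{A})$ is the set of strictly $\mathscr{P}$-free elements of $\mathcal{A}$. $G\geq_{\mathcal{A}}H$ iff $o(G+X)\geq o(H+X)$ for all $X\in\mathcal{A}$; $\equiv_{\mathcal{A}}$ is the associated equivalence. A monoid of games is a nonempty set $\mathcal{A}$ closed under $+$ that contains an identity modulo $\equiv_{\mathcal{A}}$. $\mathcal{A}$ is hereditary if it contains every option of each of its elements. $\mathcal{A}$ is integer-invertible if $n,\overline{n}\in\mathcal{A}$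 and $n+\overline{n}\equiv_{\mathcal{A}}0$ for all integers $n\ge0$. $\mathcal{A}$ is outcome-stable if for all $G,H\in\mathcal{P}(\mathcal{A})$: (1) $o(G)=o(H)=\mathscr{L}$ implies $o(G+H)=\mathscr{L}$; (2) $o(G)=o(H)=\mathscr{R}$ implies $o(G+H)=\mathscr{R}$; (3) $o(G)=\mathscr{L}$, $o(H)=\mathscr{N}$ implies $o_L(G+H)=\mathscr{L}$; (4) $o(G)=\mathscr{R}$, $o(H)=\mathscr{N}$ implies $o_R(G+H)=\mathscr{R}$. Tipping points: $\mathrm{ltp}(G)$ is the least integer $m\ge0$ with $o(G+\overline{m})=\mathscr{L}$, $\mathrm{rtp}(G)$ the least $m\ge0$ with $o(G+m)=\mathscr{R}$. $\mathcal{A}$ has Property X if for all $G,H\in\mathcal{P}(\mathcal{A})$ with $o(G)=o(H)=\mathscr{N}$: (1) if $\mathrm{rtp}(G)=\mathrm{ltp}(H)=1$, $G$ is Left end-like and $H$ is not, then $o(G+H)=\mathscr{N}$; (2) if $\mathrm{ltp}(G)=\mathrm{rtp}(H)=1$, $H$ is Right end-like and $G$ is not, then $o(G+H)=\mathscr{N}$. *)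

theory Defs
  imports Main "HOL-Library.FSet"
begin

text \<open>
  Short augmented game forms. A tombstone is not itself a game, so the two tombstones that may
  occur among the options of a form are recorded by flags.
\<close>

datatype game =
  Game (left_opts: "game fset") (right_opts: "game fset")
       (left_tomb: bool) (right_tomb: bool)

definition left_endlike :: "game \<Rightarrow> bool" where
  "left_endlike G \<longleftrightarrow> left_opts G = {||} \<or> left_tomb G"

definition right_endlike :: "game \<Rightarrow> bool" where
  "right_endlike G \<longleftrightarrow> right_opts G = {||} \<or> right_tomb G"

lemma size_left_opts: "X |\<in>| left_opts G \<Longrightarrow> size X < size G"
proof (cases G)
  case (Game A B l r)
  assume "X |\<in>| left_opts G"
  then have "Suc (size X) \<le> (\<Sum>x\<in>fset A. Suc (size x))"
    using Game by (intro member_le_sum) auto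
  then show ?thesis using Game by simp
qed

lemma size_right_opts: "X |\<in>| right_opts G \<Longrightarrow> size X < size G"
proof (cases G)
  case (Game A B l r)
  assume "X |\<in>| right_opts G"
  then have "Suc (size X) \<le> (\<Sum>x\<in>fset B. Suc (size x))"
    using Game by (intro member_le_sum) auto
  then show ?thesis using Game by simp
qed

instantiation game :: "{zero, plus}"
begin

definition zero_game :: game where
  "0 = Game {||} {||} False False"

text \<open>
  Disjunctive sum of augmented forms, following Siegel: a sum carries a Left tombstone iff both
  summands are Left end-like and at least one of them carries a Left tombstone (and symmetrically
  for Right). On forms without tombstones this is the ordinary disjunctive sum.
\<close>

function plus_game :: "game \<Rightarrow> game \<Rightarrow> game" where
  "plus_game G H =
     Game ((\<lambda>X. plus_game X H) |`| left_opts G |\<union>| (\<lambda>Y. plus_game G Y) |`| left_opts H)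
          ((\<lambda>X. plus_game X H) |`| right_opts G |\<union>| (\<lambda>Y. plus_game G Y) |`| right_opts H)
          (left_endlike G \<and> left_endlike H \<and> (left_tomb G \<or> left_tomb H))
          (right_endlike G \<and> right_endlike H \<and> (right_tomb G \<or> right_tomb H))"
  by auto
termination
  by (relation "measure (\<lambda>(G, H). size G + size H)")
     (auto dest: size_left_opts size_right_opts)

declare plus_game.simps [simp del]

instance ..

end

primrec conjugate :: "game \<Rightarrow> game" where
  "conjugate (Game A B l r) = Game (conjugate |`| B) (conjugate |`| A) r l"

primrec int_game :: "nat \<Rightarrow> game" where
  "int_game 0 = 0"
| "int_game (Suc n) = Game {|int_game n|} {||} False False"

datatype player = Left | Right

text \<open>
  \<open>o_L G\<close> (\<open>o_R G\<close>) is the winner under misere play when Left (Right) moves first.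
\<close>

function o_L :: "game \<Rightarrow> player" and o_R :: "game \<Rightarrow> player" where
  "o_L G = (if left_endlike G \<or> (\<exists>X|\<in>|left_opts G. o_R X = Left) then Left else Right)"
| "o_R G = (if right_endlike G \<or> (\<exists>X|\<in>|right_opts G. o_L X = Right) then Right else Left)"
  by pat_completeness auto
termination
  by (relation "measure (case_sum size size)") (auto dest: size_left_opts size_right_opts)

declare o_L.simps [simp del] o_R.simps [simp del]

datatype outcome = \<L> | \<N> | \<P> | \<R>

instantiation outcome :: order
begin

text \<open>\<open>\<L>\<close> is the top, \<open>\<R>\<close> the bottom; \<open>\<N>\<close> and \<open>\<P>\<close> are incomparable.\<close>

definition less_eq_outcome :: "outcome \<Rightarrow> outcome \<Rightarrow> bool" where
  "a \<le> b \<longleftrightarrow> a = b \<or> a = \<R> \<or> b = \<L>"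

definition less_outcome :: "outcome \<Rightarrow> outcome \<Rightarrow> bool" where
  "(a :: outcome) < b \<longleftrightarrow> a \<le> b \<and> \<not> b \<le> a"

instance
  by standard (auto simp: less_eq_outcome_def less_outcome_def)

end

definition outcome :: "game \<Rightarrow> outcome" where
  "outcome G =
     (case (o_L G, o_R G) of
        (Left, Left) \<Rightarrow> \<L>
      | (Left, Right) \<Rightarrow> \<N>
      | (Right, Left) \<Rightarrow> \<P>
      | (Right, Right) \<Rightarrow> \<R>)"

inductive_set subpositions :: "game \<Rightarrow> game set" for G :: game where
  refl: "G \<in> subpositions G"
| left: "H \<in> subpositions G \<Longrightarrow> X |\<in>| left_opts H \<Longrightarrow> X \<in> subpositions G"
| right: "H \<in> subpositions G \<Longrightarrow> X |\<in>| right_opts H \<Longrightarrow> X \<in> subpositions G"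

definition strictly_P_free :: "game \<Rightarrow> bool" where
  "strictly_P_free G \<longleftrightarrow> (\<forall>H\<in>subpositions G. outcome H \<noteq> \<P>)"

definition P_free_part :: "game set \<Rightarrow> game set" where
  "P_free_part A = {G \<in> A. strictly_P_free G}"

definition game_ge :: "game set \<Rightarrow> game \<Rightarrow> game \<Rightarrow> bool" where
  "game_ge A G H \<longleftrightarrow> (\<forall>X\<in>A. outcome (G + X) \<ge> outcome (H + X))"

definition game_equiv :: "game set \<Rightarrow> game \<Rightarrow> game \<Rightarrow> bool" where
  "game_equiv A G H \<longleftrightarrow> game_ge A G H \<and> game_ge A H G"

definition game_monoid :: "game set \<Rightarrow> bool" where
  "game_monoid A \<longleftrightarrow>
     A \<noteq> {} \<and> (\<forall>G\<in>A. \<forall>H\<in>A. G + H \<in> A) \<and> (\<exists>E\<in>A. \<forall>G\<in>A. game_equiv A (G + E) G)"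

definition hereditary :: "game set \<Rightarrow> bool" where
  "hereditary A \<longleftrightarrow> (\<forall>G\<in>A. \<forall>X. X |\<in>| left_opts G \<or> X |\<in>| right_opts G \<longrightarrow> X \<in> A)"

definition integer_invertible :: "game set \<Rightarrow> bool" where
  "integer_invertible A \<longleftrightarrow>
     (\<forall>n. int_game n \<in> A \<and> conjugate (int_game n) \<in> A \<and>
          game_equiv A (int_game n + conjugate (int_game n)) 0)"

definition outcome_stable :: "game set \<Rightarrow> bool" where
  "outcome_stable A \<longleftrightarrow>
     (\<forall>G\<in>P_free_part A. \<forall>H\<in>P_free_part A.
        (outcome G = \<L> \<and> outcome H = \<L> \<longrightarrow> outcome (G + H) = \<L>) \<and>
        (outcome G = \<R> \<and> outcome H = \<R> \<longrightarrow> outcome (G + H) = \<R>) \<and>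
        (outcome G = \<L> \<and> outcome H = \<N> \<longrightarrow> o_L (G + H) = Left) \<and>
        (outcome G = \<R> \<and> outcome H = \<N> \<longrightarrow> o_R (G + H) = Right))"

text \<open>
  The minima below are over nonempty sets for every \<open>G\<close>: see \<open>ltp_exists\<close> and \<open>rtp_exists\<close>.
\<close>

definition ltp :: "game \<Rightarrow> nat" where
  "ltp G = (LEAST m. outcome (G + conjugate (int_game m)) = \<L>)"

definition rtp :: "game \<Rightarrow> nat" where
  "rtp G = (LEAST m. outcome (G + int_game m) = \<R>)"

definition property_X :: "game set \<Rightarrow> bool" where
  "property_X A \<longleftrightarrow>
     (\<forall>G\<in>P_free_part A. \<forall>H\<in>P_free_part A. outcome G = \<N> \<and> outcome H = \<N> \<longrightarrow>
        (rtp G = 1 \<and> ltp H = 1 \<and> left_endlike G \<and> \<not> left_endlike H \<longrightarrow> outcome (G + H) = \<N>) \<and>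
        (ltp G = 1 \<and> rtp H = 1 \<and> right_endlike H \<and> \<not> right_endlike G \<longrightarrow> outcome (G + H) = \<N>))"

lemma conjugate_int_game_sel [simp]:
  "left_opts (conjugate (int_game m)) = {||}"
  "right_opts (conjugate (int_game m)) =
     (case m of 0 \<Rightarrow> {||} | Suc k \<Rightarrow> {|conjugate (int_game k)|})"
  "\<not> left_tomb (conjugate (int_game m))"
  "\<not> right_tomb (conjugate (int_game m))"
  by (cases m; simp add: zero_game_def)+

lemma int_game_sel [simp]:
  "right_opts (int_game m) = {||}"
  "left_opts (int_game m) = (case m of 0 \<Rightarrow> {||} | Suc k \<Rightarrow> {|int_game k|})"
  "\<not> left_tomb (int_game m)"
  "\<not> right_tomb (int_game m)"
  by (cases m; simp add: zero_game_def)+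

lemma plus_game_sel:
  fixes G H :: game
  shows "left_opts (G + H) = (\<lambda>X. X + H) |`| left_opts G |\<union>| (\<lambda>Y. G + Y) |`| left_opts H"
    and "right_opts (G + H) = (\<lambda>X. X + H) |`| right_opts G |\<union>| (\<lambda>Y. G + Y) |`| right_opts H"
    and "left_tomb (G + H) \<longleftrightarrow>
           left_endlike G \<and> left_endlike H \<and> (left_tomb G \<or> left_tomb H)"
    and "right_tomb (G + H) \<longleftrightarrow>
           right_endlike G \<and> right_endlike H \<and> (right_tomb G \<or> right_tomb H)"
  by (subst plus_game.simps, simp)+

lemma left_wins_far:
  "(size G \<le> m \<longrightarrow> o_L (G + conjugate (int_game m)) = Left) \<and>
   (size G < m \<longrightarrow> o_R (G + conjugate (int_game m)) = Left)"
proof (induction "size G + m" arbitrary: G m rule: less_induct)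
  case less
  let ?M = "conjugate (int_game m)"
  have "o_L (G + ?M) = Left" if m: "size G \<le> m"
  proof (cases "left_endlike G")
    case True
    then have "left_endlike (G + ?M)"
      by (auto simp: left_endlike_def plus_game_sel)
    then show ?thesis by (simp add: o_L.simps)
  next
    case False
    then obtain X where X: "X |\<in>| left_opts G"
      by (auto simp: left_endlike_def)
    then have "size X < size G" by (rule size_left_opts)
    then have "o_R (X + ?M) = Left" using less[of X m] m by simp
    moreover have "X + ?M |\<in>| left_opts (G + ?M)" using X by (simp add: plus_game_sel)
    ultimately show ?thesis by (subst o_L.simps) auto
  qed
  moreover have "o_R (G + ?M) = Left" if m: "size G < m"
  proof -
    from m obtain k where k: "m = Suc k" by (cases m) auto
    have "\<not> right_endlike (G + ?M)"
      by (simp add: right_endlike_def plus_game_sel k)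
    moreover have "o_L Z = Left" if Z: "Z |\<in>| right_opts (G + ?M)" for Z
    proof -
      from Z consider X where "X |\<in>| right_opts G" "Z = X + ?M"
        | "Z = G + conjugate (int_game k)"
        by (auto simp: plus_game_sel k)
      then show ?thesis
      proof cases
        case 1
        then show ?thesis using less[of X m] m size_right_opts[of X G] by simp
      next
        case 2
        then show ?thesis using less[of G k] m k by simp
      qed
    qed
    ultimately show ?thesis by (subst o_R.simps) auto
  qed
  ultimately show ?case by blast
qed

lemma right_wins_far:
  "(size G \<le> m \<longrightarrow> o_R (G + int_game m) = Right) \<and>
   (size G < m \<longrightarrow> o_L (G + int_game m) = Right)"
proof (induction "size G + m" arbitrary: G m rule: less_induct)
  case less
  let ?M = "int_game m"
  have "o_R (G + ?M) = Right" if m: "size G \<le> m"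
  proof (cases "right_endlike G")
    case True
    then have "right_endlike (G + ?M)"
      by (auto simp: right_endlike_def plus_game_sel)
    then show ?thesis by (simp add: o_R.simps)
  next
    case False
    then obtain X where X: "X |\<in>| right_opts G"
      by (auto simp: right_endlike_def)
    then have "size X < size G" by (rule size_right_opts)
    then have "o_L (X + ?M) = Right" using less[of X m] m by simp
    moreover have "X + ?M |\<in>| right_opts (G + ?M)" using X by (simp add: plus_game_sel)
    ultimately show ?thesis by (subst o_R.simps) auto
  qed
  moreover have "o_L (G + ?M) = Right" if m: "size G < m"
  proof -
    from m obtain k where k: "m = Suc k" by (cases m) auto
    have "\<not> left_endlike (G + ?M)"
      by (simp add: left_endlike_def plus_game_sel k del: int_game.simps)
    moreover have "o_R Z = Right" if Z: "Z |\<in>| left_opts (G + ?M)" for Z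
    proof -
      from Z consider X where "X |\<in>| left_opts G" "Z = X + ?M"
        | "Z = G + int_game k"
        by (auto simp: plus_game_sel k)
      then show ?thesis
      proof cases
        case 1
        then show ?thesis using less[of X m] m size_left_opts[of X G] by simp
      next
        case 2
        then show ?thesis using less[of G k] m k by simp
      qed
    qed
    ultimately show ?thesis by (subst o_L.simps) auto
  qed
  ultimately show ?case by blast
qed

lemma ltp_exists: "\<exists>m. outcome (G + conjugate (int_game m)) = \<L>"
  using left_wins_far[of G "Suc (size G)"] by (intro exI[of _ "Suc (size G)"]) (simp add: outcome_def)

lemma rtp_exists: "\<exists>m. outcome (G + int_game m) = \<R>"
  using right_wins_far[of G "Suc (size G)"] by (intro exI[of _ "Suc (size G)"]) (simp add: outcome_def)

end

theory Submission
  imports Defs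
begin

text \<open>
  Subpositions of a sum are sums of subpositions, so it suffices that no sum \<open>G + H\<close> of strictly
  \<open>\<P>\<close>-free elements has outcome \<open>\<P>\<close>. Adding an integer and cancelling it later transfers free moves between
  the summands. The key claim is that, for all integers \<open>i\<close> and \<open>j\<close>, if Left wins moving first on
  \<open>G + i\<close> and moving second on \<open>H + (j - 1)\<close>, then Left wins moving first on \<open>G + H + (i + j)\<close>.
  Quantifying over \<open>i\<close> and \<open>j\<close> makes the induction on the sizes of \<open>G\<close> and \<open>H\<close> go through: Left makes
  a winning move in one summand, and every reply of Right is again covered by the claim. Outcome
  stability and Property X settle the case in which Left has no such move.

  Given the claim, choose \<open>i\<close> with Left winning first on \<open>G + i\<close> but not on \<open>G + (i + 1)\<close>. If Left
  wins moving second on \<open>H + (- i - 1)\<close>, then Left wins moving first on \<open>G + H\<close>; otherwise outcome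
  stability applied to \<open>(G + (i + 1)) + (H + (- i - 1))\<close> shows that Right does. In neither case is
  the outcome \<open>\<P>\<close>.
\<close>

section \<open>Algebra of the disjunctive sum\<close>

lemma left_endlike_plus: "left_endlike (G + H) \<longleftrightarrow> left_endlike G \<and> left_endlike H"
  by (auto simp: left_endlike_def plus_game_sel)

lemma right_endlike_plus: "right_endlike (G + H) \<longleftrightarrow> right_endlike G \<and> right_endlike H"
  by (auto simp: right_endlike_def plus_game_sel)

lemma left_opts_plusI: "X |\<in>| left_opts G \<Longrightarrow> X + H |\<in>| left_opts (G + H)"
  by (simp add: plus_game_sel)

lemma zero_game_sel [simp]:
  "left_opts (0 :: game) = {||}" "right_opts (0 :: game) = {||}"
  "\<not> left_tomb (0 :: game)" "\<not> right_tomb (0 :: game)"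
  by (simp_all add: zero_game_def)

lemma game_add_commute: "(G :: game) + H = H + G"
proof (induction "size G + size H" arbitrary: G H rule: less_induct)
  case less
  have *: "X + H = H + X" if "X |\<in>| left_opts G \<or> X |\<in>| right_opts G" for X
    using that by (intro less) (auto dest: size_left_opts size_right_opts)
  have **: "G + Y = Y + G" if "Y |\<in>| left_opts H \<or> Y |\<in>| right_opts H" for Y
    using that by (intro less) (auto dest: size_left_opts size_right_opts)
  have "left_opts (G + H) = left_opts (H + G)" "right_opts (G + H) = right_opts (H + G)"
    using * ** by (auto simp: plus_game_sel image_iff)
  then show ?case
    by (intro game.expand) (auto simp: plus_game_sel)
qed

lemma game_add_assoc: "((G :: game) + H) + K = G + (H + K)"
proof (induction "size G + size H + size K" arbitrary: G H K rule: less_induct)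
  case less
  have 1: "(X + H) + K = X + (H + K)" if "X |\<in>| left_opts G \<or> X |\<in>| right_opts G" for X
    using that by (intro less) (auto dest: size_left_opts size_right_opts)
  have 2: "(G + X) + K = G + (X + K)" if "X |\<in>| left_opts H \<or> X |\<in>| right_opts H" for X
    using that by (intro less) (auto dest: size_left_opts size_right_opts)
  have 3: "(G + H) + X = G + (H + X)" if "X |\<in>| left_opts K \<or> X |\<in>| right_opts K" for X
    using that by (intro less) (auto dest: size_left_opts size_right_opts)
  have "left_opts ((G + H) + K) = left_opts (G + (H + K))"
    "right_opts ((G + H) + K) = right_opts (G + (H + K))"
    using 1 2 3
    by (simp_all add: plus_game_sel fimage_funion fset.map_comp comp_def funion_assoc cong: fset.map_cong)
  \<comment> \<open>Either bracketing has a Left tombstone iff all three summands are Left end-like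
    and one of them carries a Left tombstone; likewise for Right.\<close>
  then show ?case
    by (intro game.expand) (auto simp: plus_game_sel left_endlike_plus right_endlike_plus)
qed

lemma game_add_0: "(0 :: game) + G = G"
proof (induction "size G" arbitrary: G rule: less_induct)
  case less
  have "0 + X = X" if "X |\<in>| left_opts G \<or> X |\<in>| right_opts G" for X
    using that by (intro less) (auto dest: size_left_opts size_right_opts)
  then have "left_opts (0 + G) = left_opts G" "right_opts (0 + G) = right_opts G"
    by (auto simp: plus_game_sel image_iff)
  then show ?case
    by (intro game.expand) (auto simp: plus_game_sel left_endlike_def right_endlike_def)
qed

text \<open>The laws are equalities of forms, tombstones included, so sums can be rearranged without
  passing to equivalence modulo a set of games.\<close>

instance game :: comm_monoid_add
  by standard (rule game_add_assoc game_add_commute game_add_0)+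

section \<open>Integers of one sign as sums of units\<close>

lemma int_game_Suc: "int_game (Suc n) = int_game n + int_game (Suc 0)"
proof (induction n)
  case (Suc n)
  \<comment> \<open>Left can lower either summand; by the induction hypothesis both moves give the
    same form.\<close>
  have "left_opts (int_game (Suc n) + int_game (Suc 0)) = {|int_game (Suc n)|}"
    by (simp add: plus_game_sel Suc[symmetric] del: int_game.simps(2))
  then show ?case
    by (intro game.expand) (auto simp: plus_game_sel simp del: int_game.simps(2))
qed simp

lemma conjugate_0 [simp]: "conjugate 0 = 0"
  by (simp add: zero_game_def)

lemma conjugate_int_game_Suc:
  "conjugate (int_game (Suc n)) = conjugate (int_game n) + conjugate (int_game (Suc 0))"
proof (induction n)
  case (Suc n)
  have "right_opts (conjugate (int_game (Suc n)) + conjugate (int_game (Suc 0)))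
      = {|conjugate (int_game (Suc n))|}"
    by (simp add: plus_game_sel Suc[symmetric] del: int_game.simps(2))
  then show ?case
    by (intro game.expand) (auto simp: plus_game_sel simp del: int_game.simps(2))
qed simp

section \<open>Winners, outcomes and subpositions\<close>

lemma player_neq: "p \<noteq> Left \<longleftrightarrow> p = Right" "p \<noteq> Right \<longleftrightarrow> p = Left"
  by (cases p; simp)+

lemma o_L_eq_Left_iff: "o_L G = Left \<longleftrightarrow> left_endlike G \<or> (\<exists>X|\<in>|left_opts G. o_R X = Left)"
  by (simp add: o_L.simps)

lemma o_R_eq_Left_iff:
  "o_R G = Left \<longleftrightarrow> \<not> right_endlike G \<and> (\<forall>X|\<in>|right_opts G. o_L X = Left)"
  by (subst o_R.simps) (auto simp: player_neq)

lemma o_R_eq_Right_iff: "o_R G = Right \<longleftrightarrow> right_endlike G \<or> (\<exists>X|\<in>|right_opts G. o_L X = Right)"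
  by (simp add: o_R.simps)

lemma outcome_cases:
  "outcome G = \<L> \<longleftrightarrow> o_L G = Left \<and> o_R G = Left"
  "outcome G = \<N> \<longleftrightarrow> o_L G = Left \<and> o_R G = Right"
  "outcome G = \<P> \<longleftrightarrow> o_L G = Right \<and> o_R G = Left"
  "outcome G = \<R> \<longleftrightarrow> o_L G = Right \<and> o_R G = Right"
  by (cases "o_L G"; cases "o_R G"; simp add: outcome_def)+

lemma o_LR_cong:
  assumes "outcome G = outcome H"
  shows "o_L G = o_L H" "o_R G = o_R H"
  using assms by (cases "o_L G"; cases "o_R G"; cases "o_L H"; cases "o_R H"; simp add: outcome_def)+

lemma subpositions_option:
  assumes "H \<in> subpositions X" "X |\<in>| left_opts G \<or> X |\<in>| right_opts G"
  shows "H \<in> subpositions G"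
  using assms by (induction rule: subpositions.induct) (auto intro: subpositions.intros)

lemma subpositions_cases_first:
  assumes "H \<in> subpositions G"
  shows "H = G \<or> (\<exists>X. (X |\<in>| left_opts G \<or> X |\<in>| right_opts G) \<and> H \<in> subpositions X)"
  using assms by (induction rule: subpositions.induct) (blast intro: subpositions.intros)+

lemma strictly_P_free_iff:
  "strictly_P_free G \<longleftrightarrow> outcome G \<noteq> \<P> \<and>
     (\<forall>X. X |\<in>| left_opts G \<or> X |\<in>| right_opts G \<longrightarrow> strictly_P_free X)"
  unfolding strictly_P_free_def
  using subpositions_option subpositions_cases_first subpositions.refl by metis

text \<open>Treats shifts of either sign uniformly. It is additive on forms only for equal signs:
  \<open>integer 1 + integer (- 1)\<close> is not the form \<open>0\<close>, and cancellation holds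
  only at the level of outcomes.\<close>

definition integer :: "int \<Rightarrow> game" where
  "integer k = (if k \<ge> 0 then int_game (nat k) else conjugate (int_game (nat (- k))))"

lemma integer_0 [simp]: "integer 0 = 0"
  by (simp add: integer_def)

lemma integer_of_nat: "integer (int n) = int_game n"
  by (simp add: integer_def)

lemma integer_uminus_of_nat: "integer (- int n) = conjugate (int_game n)"
  by (simp add: integer_def)

lemma integer_sel:
  "left_opts (integer k) = (if k > 0 then {|integer (k - 1)|} else {||})"
  "right_opts (integer k) = (if k < 0 then {|integer (k + 1)|} else {||})"
  "\<not> left_tomb (integer k)" "\<not> right_tomb (integer k)"
proof -
  have "left_opts (integer (int n)) = (if n > 0 then {|integer (int n - 1)|} else {||})" for n
    unfolding integer_of_nat by (cases n) (simp_all add: integer_of_nat del: int_game.simps(2))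
  moreover have "right_opts (integer (- int n)) = (if n > 0 then {|integer (- int n + 1)|} else {||})" for n
    unfolding integer_uminus_of_nat by (cases n) (simp_all add: integer_uminus_of_nat del: int_game.simps(2))
  ultimately show "left_opts (integer k) = (if k > 0 then {|integer (k - 1)|} else {||})"
    "right_opts (integer k) = (if k < 0 then {|integer (k + 1)|} else {||})"
    by (cases k rule: int_cases4; force simp: integer_of_nat integer_uminus_of_nat)+
qed (simp_all add: integer_def)

lemma integer_Suc: "integer (int (Suc n)) = integer (int n) + integer 1"
  unfolding integer_of_nat using int_game_Suc[of n] integer_of_nat[of 1] by simp

lemma integer_uminus_Suc: "integer (- int (Suc n)) = integer (- int n) + integer (- 1)"
  unfolding integer_uminus_of_nat
  using conjugate_int_game_Suc[of n] integer_uminus_of_nat[of 1] by simp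

lemma left_endlike_integer: "left_endlike (integer k) \<longleftrightarrow> k \<le> 0"
  by (auto simp: left_endlike_def integer_sel)

lemma right_endlike_integer: "right_endlike (integer k) \<longleftrightarrow> k \<ge> 0"
  by (auto simp: right_endlike_def integer_sel)

lemma left_opts_plus_integer:
  "X |\<in>| left_opts (G + integer k) \<longleftrightarrow>
     (\<exists>Y. Y |\<in>| left_opts G \<and> X = Y + integer k) \<or> (k > 0 \<and> X = G + integer (k - 1))"
  by (auto simp: plus_game_sel integer_sel)

lemma right_opts_plus_integer:
  "X |\<in>| right_opts (G + integer k) \<longleftrightarrow>
     (\<exists>Y. Y |\<in>| right_opts G \<and> X = Y + integer k) \<or> (k < 0 \<and> X = G + integer (k + 1))"
  by (auto simp: plus_game_sel integer_sel)


section \<open>Unit shifts, replies in shifted sums and tipping points\<close>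

lemma outcome_0: "outcome 0 = \<N>"
  by (simp add: outcome_cases o_L_eq_Left_iff o_R_eq_Right_iff left_endlike_def right_endlike_def)

lemma outcome_integer_1: "outcome (integer 1) = \<R>" "outcome (integer (- 1)) = \<L>"
proof -
  have "o_L (integer 1) \<noteq> Left"
    unfolding o_L_eq_Left_iff[of "integer 1"] using outcome_0
    by (simp add: outcome_cases left_endlike_integer integer_sel)
  moreover have "o_R (integer 1) = Right"
    unfolding o_R_eq_Right_iff[of "integer 1"] by (simp add: right_endlike_integer)
  moreover have "o_L (integer (- 1)) = Left"
    unfolding o_L_eq_Left_iff[of "integer (- 1)"] by (simp add: left_endlike_integer)
  moreover have "o_R (integer (- 1)) = Left"
    unfolding o_R_eq_Left_iff[of "integer (- 1)"] using outcome_0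
    by (simp add: outcome_cases right_endlike_integer integer_sel)
  ultimately show "outcome (integer 1) = \<R>" "outcome (integer (- 1)) = \<L>"
    by (auto simp: outcome_cases player_neq)
qed

lemma strictly_P_free_integer_1:
  "strictly_P_free 0" "strictly_P_free (integer 1)" "strictly_P_free (integer (- 1))"
proof -
  show 0: "strictly_P_free 0"
    by (subst strictly_P_free_iff) (simp add: outcome_0)
  show "strictly_P_free (integer 1)" "strictly_P_free (integer (- 1))"
    by (subst strictly_P_free_iff, simp add: outcome_integer_1 integer_sel 0)+
qed

text \<open>Left moves from \<open>integer 1\<close> to \<open>0\<close> and then plays second on
  \<open>G\<close>.\<close>

lemma o_L_plus_1: "o_R G = Left \<Longrightarrow> o_L (G + integer 1) = Left"
  by (auto simp: o_L_eq_Left_iff[of "G + _"] left_opts_plus_integer)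

lemma o_R_minus_1: "o_L G = Right \<Longrightarrow> o_R (G + integer (- 1)) = Right"
  by (auto simp: o_R_eq_Right_iff[of "G + _"] right_opts_plus_integer)

lemma rtp_eq_1: "outcome G = \<N> \<Longrightarrow> outcome (G + integer 1) = \<R> \<Longrightarrow> rtp G = 1"
  unfolding rtp_def
  by (rule Least_equality) (use integer_of_nat[of 1] in \<open>auto intro!: Suc_leI gr0I\<close>)

lemma ltp_eq_1: "outcome G = \<N> \<Longrightarrow> outcome (G + integer (- 1)) = \<L> \<Longrightarrow> ltp G = 1"
  unfolding ltp_def
  by (rule Least_equality) (use integer_uminus_of_nat[of 1] in \<open>auto intro!: Suc_leI gr0I\<close>)

text \<open>Right has four kinds of reply, one for each component. Premise \<open>K\<close> ensures
  that Right does not win at once: a sum is Right end-like only if both summands are.\<close>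

lemma o_R_sum_shift_eq_Left:
  assumes K: "o_R (K + integer i) = Left"
    and 1: "\<And>Y. Y |\<in>| right_opts K \<Longrightarrow> o_L ((Y + integer i) + (H + integer j)) = Left"
    and 2: "i < 0 \<Longrightarrow> o_L ((K + integer (i + 1)) + (H + integer j)) = Left"
    and 3: "\<And>Y. Y |\<in>| right_opts H \<Longrightarrow> o_L ((K + integer i) + (Y + integer j)) = Left"
    and 4: "j < 0 \<Longrightarrow> o_L ((K + integer i) + (H + integer (j + 1))) = Left"
  shows "o_R ((K + integer i) + (H + integer j)) = Left"
proof -
  have "\<not> right_endlike (K + integer i)"
    using K by (simp add: o_R_eq_Left_iff)
  moreover have "o_L Z = Left" if "Z |\<in>| right_opts ((K + integer i) + (H + integer j))" for Z
    using that 1 2 3 4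
    unfolding plus_game_sel(2)[of "K + _"] by (auto simp: right_opts_plus_integer)
  ultimately show ?thesis
    unfolding o_R_eq_Left_iff[of "_ + _ + _"] right_endlike_plus[of "_ + _"] by blast
qed

lemma o_L_right_option:
  assumes "o_R (G + integer k) = Left" "Y |\<in>| right_opts G"
  shows "o_L (Y + integer k) = Left"
  using assms right_opts_plus_integer[of "Y + integer k" G k]
  unfolding o_R_eq_Left_iff[of "G + integer k"] by blast

text \<open>Moving first, Left wins at the shift \<open>- int (size G)\<close> and loses at
  \<open>int (Suc (size G))\<close>, so the winner changes between two consecutive shifts.\<close>

lemma left_tipping_shift: "\<exists>i. o_L (G + integer i) = Left \<and> o_L (G + integer (i + 1)) = Right"
proof (rule ccontr)
  assume "\<not> ?thesis"
  then have tip: "o_L (G + integer (i + 1)) = Left" if "o_L (G + integer i) = Left" for i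
    using that player_neq by blast
  have "o_L (G + integer i) = Left" if "i \<ge> - int (size G)" for i
    using that
  proof (induction rule: int_ge_induct)
    case base
    then show ?case using left_wins_far[of G "size G"] by (simp add: integer_uminus_of_nat)
  next
    case (step i)
    then show ?case using tip by blast
  qed
  from this[of "int (Suc (size G))"] show False
    using right_wins_far[of G "Suc (size G)"] by (simp add: integer_of_nat del: of_nat_Suc)
qed

section \<open>Strictly \<P>-free elements and integer shifts\<close>

locale stable_monoid =
  fixes A :: "game set"
  assumes monoid: "game_monoid A"
    and stable: "outcome_stable A"
    and hereditary: "hereditary A"
    and invertible: "integer_invertible A"
    and X: "property_X A"
begin

abbreviation "PA \<equiv> P_free_part A"

lemma A_add: "G \<in> A \<Longrightarrow> H \<in> A \<Longrightarrow> G + H \<in> A"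
  using monoid by (auto simp: game_monoid_def)

lemma A_integer: "integer k \<in> A"
  using invertible by (auto simp: integer_invertible_def integer_def)

lemma PA_imp_A: "G \<in> PA \<Longrightarrow> G \<in> A"
  by (simp add: P_free_part_def)

lemma PA_option: "G \<in> PA \<Longrightarrow> X |\<in>| left_opts G \<or> X |\<in>| right_opts G \<Longrightarrow> X \<in> PA"
  using hereditary strictly_P_free_iff[of G] unfolding P_free_part_def hereditary_def by blast

lemma PA_outcome: "G \<in> PA \<Longrightarrow> o_L G = Left \<or> o_R G = Right"
  using strictly_P_free_iff[of G]
  by (cases "o_L G"; cases "o_R G") (auto simp: P_free_part_def outcome_cases)

text \<open>Every option of a sum replaces one summand by an option of it, so closure reduces to
  outcomes. Restricting \<open>H'\<close> to subpositions of \<open>H\<close> leaves only finitely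
  many cases when \<open>H\<close> is a unit integer.\<close>

lemma PA_addI:
  assumes "G \<in> PA" "H \<in> PA"
    and step: "\<And>G' H'. G' \<in> PA \<Longrightarrow> H' \<in> subpositions H \<Longrightarrow> H' \<in> PA \<Longrightarrow> outcome (G' + H') \<noteq> \<P>"
  shows "G + H \<in> PA"
proof -
  have "strictly_P_free (G + H')" if "G \<in> PA" "H' \<in> PA" "H' \<in> subpositions H" for G H'
    using that
  proof (induction "size G + size H'" arbitrary: G H' rule: less_induct)
    case less
    have "strictly_P_free (X + H')" if "X |\<in>| left_opts G \<or> X |\<in>| right_opts G" for X
      using that less.prems PA_option[of G X]
      by (intro less.hyps) (auto dest: size_left_opts size_right_opts)
    moreover have "strictly_P_free (G + Y)" if "Y |\<in>| left_opts H' \<or> Y |\<in>| right_opts H'" for Y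
      using that less.prems PA_option[of H' Y]
      by (intro less.hyps) (auto dest: size_left_opts size_right_opts intro: subpositions.intros)
    ultimately show ?case
      using step[of G H'] less.prems
      by (subst strictly_P_free_iff) (auto simp: plus_game_sel)
  qed
  then show ?thesis
    using assms A_add by (auto simp: P_free_part_def intro: subpositions.refl)
qed

text \<open>Units of equal sign add as forms; opposite units cancel by integer invertibility. The
  second integer is transferred one unit at a time.\<close>

lemma outcome_integer_cancel:
  assumes "G \<in> A"
  shows "outcome (G + (integer k + integer l)) = outcome (G + integer (k + l))"
proof -
  have cancel: "outcome (K + (int_game n + conjugate (int_game n))) = outcome K" if "K \<in> A" for K n
    using invertible that
    by (auto simp: integer_invertible_def game_equiv_def game_ge_def add.commute intro: antisym)
  have cancel1: "outcome (K + (integer 1 + integer (- 1))) = outcome K" if "K \<in> A" for K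
    using cancel[of K 1] that by (simp add: integer_def)
  have succ: "outcome (K + (integer k + integer 1)) = outcome (K + integer (k + 1))" if "K \<in> A" for K k
  proof (cases k rule: int_cases4)
    case (nonneg n)
    then show ?thesis using integer_Suc[of n] by (simp add: add.commute)
  next
    case (neg n)
    then obtain m where "k = - int (Suc m)" by (cases n) auto
    then have "integer k + integer 1 = integer (k + 1) + (integer 1 + integer (- 1))"
      using integer_uminus_Suc[of m] by (simp add: ac_simps)
    then show ?thesis
      using cancel1[of "K + integer (k + 1)"] that by (simp add: A_add A_integer add.assoc)
  qed
  have pred: "outcome (K + (integer k + integer (- 1))) = outcome (K + integer (k - 1))" if "K \<in> A" for K k
  proof (cases k rule: int_cases3)
    case zero
    then show ?thesis by simp
  next
    case (neg n)
    then have "k - 1 = - int (Suc n)" by simp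
    then have "integer (k - 1) = integer k + integer (- 1)"
      using integer_uminus_Suc[of n] neg by (simp only:)
    then show ?thesis by simp
  next
    case (pos n)
    then obtain m where "k = int (Suc m)" by (cases n) auto
    then have "integer k + integer (- 1) = integer (k - 1) + (integer 1 + integer (- 1))"
      using integer_Suc[of m] by (simp add: ac_simps)
    then show ?thesis
      using cancel1[of "K + integer (k - 1)"] that by (simp add: A_add A_integer add.assoc)
  qed
  have nonneg: "outcome (G + (integer k + integer (int n))) = outcome (G + integer (k + int n))" for k n
  proof (induction n arbitrary: k)
    case (Suc n)
    have "outcome (G + (integer k + integer (int (Suc n)))) =
        outcome ((G + integer (int n)) + (integer k + integer 1))"
      \<comment> \<open>The units still to be transferred are absorbed into the game
        \<open>K\<close> of the unit step.\<close>
      by (simp only: integer_Suc ac_simps)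
    also have "\<dots> = outcome (G + (integer (k + 1) + integer (int n)))"
      using assms by (subst succ) (auto intro: A_add A_integer simp: ac_simps)
    finally show ?case
      using Suc[of "k + 1"] by (simp add: ac_simps)
  qed simp
  have nonpos: "outcome (G + (integer k + integer (- int n))) = outcome (G + integer (k - int n))" for k n
  proof (induction n arbitrary: k)
    case (Suc n)
    have "outcome (G + (integer k + integer (- int (Suc n)))) =
        outcome ((G + integer (- int n)) + (integer k + integer (- 1)))"
      by (simp only: integer_uminus_Suc ac_simps)
    also have "\<dots> = outcome (G + (integer (k - 1) + integer (- int n)))"
      using assms by (subst pred) (auto intro: A_add A_integer simp: ac_simps)
    finally show ?case
      using Suc[of "k - 1"] by (simp add: algebra_simps)
  qed simp
  show ?thesis
    using nonneg[of k] nonpos[of k] by (cases l rule: int_cases2) auto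
qed

lemma outcome_shift:
  assumes "G \<in> A" "H \<in> A" "i + j = k"
  shows "outcome ((G + integer i) + (H + integer j)) = outcome (G + H + integer k)"
  using outcome_integer_cancel[of "G + H" i j] assms by (simp add: A_add ac_simps)

lemmas o_shift = o_LR_cong[OF outcome_shift]

text \<open>A strictly \<P>-free game that Left wins moving second has outcome \<L>, and one that
  Left wins moving first has outcome \<L> or \<N>. Two clauses of outcome stability thus merge into
  one rule for each player.\<close>

lemma stableD:
  assumes "G \<in> PA" "H \<in> PA"
  shows "o_R G = Left \<Longrightarrow> o_L H = Left \<Longrightarrow> o_L (G + H) = Left"
    and "o_L G = Right \<Longrightarrow> o_R H = Right \<Longrightarrow> o_R (G + H) = Right"
proof -
  have *: "(outcome G = \<L> \<and> outcome H = \<L> \<longrightarrow> outcome (G + H) = \<L>) \<and>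
        (outcome G = \<R> \<and> outcome H = \<R> \<longrightarrow> outcome (G + H) = \<R>) \<and>
        (outcome G = \<L> \<and> outcome H = \<N> \<longrightarrow> o_L (G + H) = Left) \<and>
        (outcome G = \<R> \<and> outcome H = \<N> \<longrightarrow> o_R (G + H) = Right)"
    using stable assms unfolding outcome_stable_def by blast
  show "o_L (G + H) = Left" if "o_R G = Left" "o_L H = Left"
    using * that PA_outcome[OF assms(1)] by (cases "o_R H") (auto simp: outcome_cases)
  show "o_R (G + H) = Right" if "o_L G = Right" "o_R H = Right"
    using * that PA_outcome[OF assms(1)] by (cases "o_L H") (auto simp: outcome_cases)
qed

lemma PA_integer_1: "0 \<in> PA" "integer 1 \<in> PA" "integer (- 1) \<in> PA"
  using strictly_P_free_integer_1 A_integer[of 0] A_integer by (auto simp: P_free_part_def)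

text \<open>If Right wins \<open>G'\<close> moving first, stability with \<open>integer 1\<close>,
  of outcome \<R>, gives Right the sum moving first. Otherwise Left wins the sum moving first by
  spending the unit.\<close>

lemma PA_add_1: "G \<in> PA \<Longrightarrow> G + integer 1 \<in> PA"
proof (rule PA_addI[OF _ PA_integer_1(2)])
  fix G' H' assume G': "G' \<in> PA" and H': "H' \<in> subpositions (integer 1)"
  have "H' = integer 1 \<or> H' = 0"
    using H' by (induction rule: subpositions.induct) (auto simp: integer_sel)
  moreover have "outcome (G' + integer 1) \<noteq> \<P>"
    using stableD(2)[OF PA_integer_1(2) G'] o_L_plus_1[of G'] outcome_integer_1
    by (cases "o_R G'") (auto simp: outcome_cases add.commute)
  ultimately show "outcome (G' + H') \<noteq> \<P>"
    using G' PA_outcome[of G'] by (auto simp: outcome_cases)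
qed

lemma PA_minus_1: "G \<in> PA \<Longrightarrow> G + integer (- 1) \<in> PA"
proof (rule PA_addI[OF _ PA_integer_1(3)])
  fix G' H' assume G': "G' \<in> PA" and H': "H' \<in> subpositions (integer (- 1))"
  have "H' = integer (- 1) \<or> H' = 0"
    using H' by (induction rule: subpositions.induct) (auto simp: integer_sel)
  moreover have "outcome (G' + integer (- 1)) \<noteq> \<P>"
    using stableD(1)[OF PA_integer_1(3) G'] o_R_minus_1[of G'] outcome_integer_1
    by (cases "o_L G'") (auto simp: outcome_cases add.commute)
  ultimately show "outcome (G' + H') \<noteq> \<P>"
    using G' PA_outcome[of G'] by (auto simp: outcome_cases)
qed

lemma PA_shift:
  assumes "G \<in> PA"
  shows "G + integer k \<in> PA"
proof -
  have "G + integer (int n) \<in> PA" for n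
  proof (induction n)
    case (Suc n)
    then show ?case
      using PA_add_1[of "G + integer (int n)"] integer_Suc[of n] by (simp add: ac_simps)
  qed (use assms in simp)
  moreover have "G + integer (- int n) \<in> PA" for n
  proof (induction n)
    case (Suc n)
    then show ?case
      using PA_minus_1[of "G + integer (- int n)"] integer_uminus_Suc[of n] by (simp add: ac_simps)
  qed (use assms in simp)
  ultimately show ?thesis
    by (cases k rule: int_cases2) auto
qed

section \<open>The key claim on Left's first move\<close>

lemma o_L_shift_succ:
  assumes "G \<in> A" "o_R (G + integer (k - 1)) = Left"
  shows "o_L (G + integer k) = Left"
  using o_L_plus_1[OF assms(2)] o_LR_cong(1)[OF outcome_integer_cancel[OF assms(1), of "k - 1" 1]]
  by (simp add: add.assoc)

text \<open>If Left lost, stability would force \<open>G'\<close> and \<open>H'\<close> to have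
  outcome \<N>, with right tipping point 1 for \<open>G'\<close> and left tipping point 1 for
  \<open>H'\<close>. This is the situation of Property X, which makes the sum \<N>.\<close>

lemma left_wins_sum_endlike:
  assumes G: "G \<in> PA" and H: "H \<in> PA"
    and Gi: "o_L (G + integer i) = Left" and Hj: "o_R (H + integer (j - 1)) = Left"
    and endlike: "left_endlike (G + integer i)"
  shows "o_L (G + H + integer (i + j)) = Left"
proof (rule ccontr)
  assume contra: "\<not> ?thesis"
  define G' where "G' = G + integer i"
  define H' where "H' = H + integer j"
  have PA: "G' \<in> PA" "H' \<in> PA" "G + integer (i + 1) \<in> PA" "H + integer (j - 1) \<in> PA"
    unfolding G'_def H'_def using G H by (auto intro: PA_shift)
  have contra': "o_L (G' + H') \<noteq> Left"
    using contra o_shift(1)[of G H i j] G H by (simp add: G'_def H'_def PA_imp_A)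
  have "o_L (H') = Left"
    unfolding H'_def using H Hj by (intro o_L_shift_succ PA_imp_A)
  moreover have "o_R H' = Right"
    using stableD(1)[of H' G'] PA Gi contra' by (cases "o_R H'") (auto simp: G'_def add.commute)
  ultimately have H'N: "outcome H' = \<N>" by (simp add: outcome_cases)
  have "o_L (G + integer (i + 1)) = Right"
  proof (rule ccontr)
    assume "o_L (G + integer (i + 1)) \<noteq> Right"
    \<comment> \<open>One unit is moved from \<open>H'\<close> to \<open>G'\<close>; the total shift
      is unchanged.\<close>
    then have "o_L ((H + integer (j - 1)) + (G + integer (i + 1))) = Left"
      using stableD(1)[OF PA(4,3)] Hj by (simp add: player_neq)
    then show False
      using contra o_shift(1)[of H G "j - 1" "i + 1" "i + j"] G H by (simp add: PA_imp_A ac_simps)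
  qed
  then have "outcome (G + integer (i + 1)) = \<R>"
    using PA_outcome[OF PA(3)] by (simp add: outcome_cases)
  then have G'1: "outcome (G' + integer 1) = \<R>"
    using outcome_integer_cancel[of G i 1] G by (simp add: G'_def PA_imp_A add.assoc)
  have "o_R G' = Right"
    using o_L_plus_1[of G'] G'1 by (cases "o_R G'") (auto simp: outcome_cases)
  then have G'N: "outcome G' = \<N>" using Gi by (simp add: outcome_cases G'_def)
  have "outcome (H + integer (j - 1)) = \<L>"
    using PA_outcome[OF PA(4)] Hj by (simp add: outcome_cases)
  then have H'1: "outcome (H' + integer (- 1)) = \<L>"
    using outcome_integer_cancel[of H j "- 1"] H by (simp add: H'_def PA_imp_A add.assoc)
  \<comment> \<open>Otherwise the whole sum would be Left end-like and Left would win it moving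
    first.\<close>
  have "\<not> left_endlike H'"
    using contra' endlike by (auto simp: o_L_eq_Left_iff left_endlike_plus G'_def)
  then have "outcome (G' + H') = \<N>"
    using X PA(1,2) G'N H'N rtp_eq_1[OF G'N G'1] ltp_eq_1[OF H'N H'1] endlike
    unfolding property_X_def G'_def by blast
  then show False using contra' by (simp add: outcome_cases)
qed

text \<open>The condition is asymmetric. For \<open>H\<close> in \<open>A\<close>, the one on
  \<open>H\<close> implies that Left wins moving first on \<open>H + integer j\<close>, by spending
  one unit.\<close>

definition left_wins_sum :: "game \<Rightarrow> game \<Rightarrow> bool" where
  "left_wins_sum G H \<longleftrightarrow> (\<forall>i j. o_L (G + integer i) = Left \<longrightarrow> o_R (H + integer (j - 1)) = Left \<longrightarrow>
     o_L (G + H + integer (i + j)) = Left)"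

text \<open>Only the total shift matters, so the split \<open>i'\<close>, \<open>j'\<close> under
  which the claim applies may differ from the split \<open>i\<close>, \<open>j\<close> on the board.
  The second conclusion serves replies after which the summands exchange roles.\<close>

lemma left_wins_sumD:
  assumes "left_wins_sum G H" "G \<in> A" "H \<in> A"
    and "o_L (G + integer i') = Left" "o_R (H + integer (j' - 1)) = Left" "i' + j' = i + j"
  shows "o_L ((G + integer i) + (H + integer j)) = Left" "o_L ((H + integer i) + (G + integer j)) = Left"
proof -
  have "o_L (G + H + integer (i + j)) = Left"
    using assms unfolding left_wins_sum_def by metis
  then show "o_L ((G + integer i) + (H + integer j)) = Left"
    "o_L ((H + integer i) + (G + integer j)) = Left"
    using o_shift(1)[of G H i j] o_shift(1)[of H G i j] assms by (simp_all add: add.commute[of H G])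
qed

text \<open>Left moves from \<open>G\<close> to \<open>K\<close>. Each reply of Right leaves a pair
  of smaller total size on which Left wins one part moving first and the other moving
  second.\<close>

lemma left_wins_sum_option:
  assumes G: "G \<in> PA" and H: "H \<in> PA"
    and IH: "\<And>K L. K \<in> PA \<Longrightarrow> L \<in> PA \<Longrightarrow> size K + size L < size G + size H \<Longrightarrow> left_wins_sum K L"
    and K: "K |\<in>| left_opts G" and Ki: "o_R (K + integer i) = Left"
    and Hj: "o_R (H + integer (j - 1)) = Left"
  shows "o_L (G + H + integer (i + j)) = Left"
proof -
  have KPA: "K \<in> PA" and sK: "size K < size G"
    using G K by (auto intro: PA_option size_left_opts)
  have "o_R ((K + integer i) + (H + integer j)) = Left"
  proof (rule o_R_sum_shift_eq_Left[OF Ki])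
    fix Y assume Y: "Y |\<in>| right_opts K"
    then have "Y \<in> PA" "size Y < size K"
      using KPA by (auto intro: PA_option size_right_opts)
    then show "o_L ((Y + integer i) + (H + integer j)) = Left"
      using IH[of Y H] H sK o_L_right_option[OF Ki Y] Hj
      by (intro left_wins_sumD(1)) (auto intro: PA_imp_A)
  next
    show "o_L ((K + integer (i + 1)) + (H + integer j)) = Left"
      using IH[of K H] KPA H sK Hj Ki
      by (intro left_wins_sumD(1)[where i' = "i + 1"]) (auto intro: PA_imp_A o_L_shift_succ)
  next
    fix Y assume Y: "Y |\<in>| right_opts H"
    then have "Y \<in> PA" "size Y < size H"
      using H by (auto intro: PA_option size_right_opts)
    then show "o_L ((K + integer i) + (Y + integer j)) = Left"
      using IH[of Y K] KPA sK o_L_right_option[OF Hj Y] Ki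
      \<comment> \<open>After a reply in \<open>H\<close>, Left moves first on
        \<open>Y + integer (j - 1)\<close> and second on \<open>K + integer i\<close>, so
        \<open>Y\<close> takes the role of the first summand.\<close>
      by (intro left_wins_sumD(2)[where i' = "j - 1" and j' = "i + 1"]) (auto intro: PA_imp_A)
  next
    show "o_L ((K + integer i) + (H + integer (j + 1))) = Left"
      using IH[of H K] KPA H sK Hj Ki
      \<comment> \<open>Right's move raises the total to \<open>i + j + 1\<close>. Left wins moving
        first on \<open>H + integer j\<close>, and the extra unit goes to \<open>K\<close>.\<close>
      by (intro left_wins_sumD(2)[where i' = j and j' = "i + 1"]) (auto intro: PA_imp_A o_L_shift_succ)
  qed
  moreover have "(K + integer i) + (H + integer j) |\<in>| left_opts ((G + integer i) + (H + integer j))"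
    using K left_opts_plus_integer by (intro left_opts_plusI) blast
  ultimately have "o_L ((G + integer i) + (H + integer j)) = Left"
    unfolding o_L_eq_Left_iff[of "_ + _ + _"] by blast
  then show ?thesis
    using o_shift(1)[of G H i j] G H by (simp add: PA_imp_A)
qed

text \<open>Left spends one unit of \<open>i\<close>. A reply in an integer would leave
  \<open>G\<close> and \<open>H\<close> intact, out of reach of the induction; positivity of
  \<open>i\<close> and \<open>j\<close> rules it out.\<close>

lemma left_wins_sum_integer:
  assumes G: "G \<in> PA" and H: "H \<in> PA"
    and IH: "\<And>K L. K \<in> PA \<Longrightarrow> L \<in> PA \<Longrightarrow> size K + size L < size G + size H \<Longrightarrow> left_wins_sum K L"
    and pos: "i > 0" "j > 0" and Gi: "o_R (G + integer (i - 1)) = Left"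
    and Hj: "o_R (H + integer (j - 1)) = Left"
  shows "o_L (G + H + integer (i + j)) = Left"
proof -
  have "o_R ((G + integer (i - 1)) + (H + integer j)) = Left"
  proof (rule o_R_sum_shift_eq_Left[OF Gi])
    fix Y assume Y: "Y |\<in>| right_opts G"
    then have "Y \<in> PA" "size Y < size G"
      using G by (auto intro: PA_option size_right_opts)
    then show "o_L ((Y + integer (i - 1)) + (H + integer j)) = Left"
      using IH[of Y H] H o_L_right_option[OF Gi Y] Hj
      by (intro left_wins_sumD(1)) (auto intro: PA_imp_A)
  next
    fix Y assume Y: "Y |\<in>| right_opts H"
    then have "Y \<in> PA" "size Y < size H"
      using H by (auto intro: PA_option size_right_opts)
    then show "o_L ((G + integer (i - 1)) + (Y + integer j)) = Left"
      using IH[of Y G] G o_L_right_option[OF Hj Y] Gi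
      by (intro left_wins_sumD(2)[where i' = "j - 1" and j' = i]) (auto intro: PA_imp_A)
  \<comment> \<open>Neither \<open>i - 1\<close> nor \<open>j\<close> is negative, so Right has no
    move in the integers.\<close>
  qed (use pos in auto)
  moreover have "(G + integer (i - 1)) + (H + integer j) |\<in>| left_opts ((G + integer i) + (H + integer j))"
    using pos left_opts_plus_integer by (intro left_opts_plusI) blast
  ultimately have "o_L ((G + integer i) + (H + integer j)) = Left"
    unfolding o_L_eq_Left_iff[of "_ + _ + _"] by blast
  then show ?thesis
    using o_shift(1)[of G H i j] G H by (simp add: PA_imp_A)
qed

lemma left_wins_sum: "G \<in> PA \<Longrightarrow> H \<in> PA \<Longrightarrow> left_wins_sum G H"
proof (induction "size G + size H" arbitrary: G H rule: less_induct)
  case less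
  note G = less.prems(1) and H = less.prems(2)
  have IH: "left_wins_sum K L" if "K \<in> PA" "L \<in> PA" "size K + size L < size G + size H" for K L
    using less.hyps that by blast
  show ?case
    unfolding left_wins_sum_def
  proof (intro allI impI)
    fix i j assume Gi: "o_L (G + integer i) = Left" and Hj: "o_R (H + integer (j - 1)) = Left"
    consider (endlike) "left_endlike (G + integer i)"
      | (option) K where "K |\<in>| left_opts G" "o_R (K + integer i) = Left"
      | (integer) "i > 0" "o_R (G + integer (i - 1)) = Left"
      using Gi unfolding o_L_eq_Left_iff[of "G + _"] by (auto simp: left_opts_plus_integer)
    then show "o_L (G + H + integer (i + j)) = Left"
    proof cases
      case endlike
      then show ?thesis using left_wins_sum_endlike G H Gi Hj by blast
    next
      case option
      then show ?thesis using left_wins_sum_option[OF G H IH] Hj by blast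
    next
      case integer
      \<comment> \<open>Right could undo Left's move in the integer \<open>i\<close> by a move in \<open>j < 0\<close>. The hypotheses now
        also hold with the summands exchanged, which excludes this.\<close>
      have swap: "G + H + integer (i + j) = H + G + integer (j + i)"
        by (simp add: ac_simps)
      have Hj': "o_L (H + integer j) = Left"
        using H Hj by (intro o_L_shift_succ PA_imp_A)
      consider (endlike) "left_endlike (H + integer j)"
        | (option) K where "K |\<in>| left_opts H" "o_R (K + integer j) = Left"
        | (integer) "j > 0"
        using Hj' unfolding o_L_eq_Left_iff[of "H + _"] by (auto simp: left_opts_plus_integer)
      then show ?thesis
      proof cases
        case endlike
        then show ?thesis
          unfolding swap using left_wins_sum_endlike G H Hj' integer(2) by blast
      next
        case option
        have "left_wins_sum K L" if "K \<in> PA" "L \<in> PA" "size K + size L < size H + size G" for K L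
          using IH that by (simp add: add.commute)
        then show ?thesis
          unfolding swap using left_wins_sum_option[OF H G] option integer(2) by blast
      next
        case j: integer
        then show ?thesis using left_wins_sum_integer[OF G H IH] integer Hj by blast
      qed
    qed
  qed
qed

section \<open>Sums never have outcome \<P>, and closure follows\<close>

lemma sum_not_P:
  assumes G: "G \<in> PA" and H: "H \<in> PA"
  shows "outcome (G + H) \<noteq> \<P>"
proof
  assume P: "outcome (G + H) = \<P>"
  obtain i where i: "o_L (G + integer i) = Left" "o_L (G + integer (i + 1)) = Right"
    using left_tipping_shift by blast
  \<comment> \<open>The key claim with \<open>j = - i\<close> makes the total shift zero.\<close>
  have "o_L (G + H + integer (i + - i)) = Left" if "o_R (H + integer (- i - 1)) = Left"
    using left_wins_sum[OF G H] i(1) that unfolding left_wins_sum_def by blast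
  then have "o_R (H + integer (- i - 1)) \<noteq> Left"
    using P by (auto simp: outcome_cases)
  then have "o_R ((G + integer (i + 1)) + (H + integer (- i - 1))) = Right"
    using stableD(2)[OF PA_shift[OF G] PA_shift[OF H]] i(2) by (simp add: player_neq)
  then show False
    using P o_shift(2)[of G H "i + 1" "- i - 1" 0] G H by (simp add: PA_imp_A outcome_cases)
qed

lemma game_monoid_PA: "game_monoid PA"
  unfolding game_monoid_def
proof (intro conjI ballI)
  show "PA \<noteq> {}" using PA_integer_1 by blast
  show "G + H \<in> PA" if "G \<in> PA" "H \<in> PA" for G H
    using that sum_not_P by (intro PA_addI) auto
  show "\<exists>E\<in>PA. \<forall>G\<in>PA. game_equiv PA (G + E) G"
    \<comment> \<open>As a form, \<open>0\<close> is neutral for the sum, so it is an identity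
      modulo any set of games.\<close>
    using PA_integer_1(1) by (intro bexI[of _ 0]) (auto simp: game_equiv_def game_ge_def)
qed

end

theorem theorem3p19:
  fixes A :: "game set"
  assumes "game_monoid A"
    and "outcome_stable A"
    and "hereditary A"
    and "integer_invertible A"
    and "property_X A"
  shows "game_monoid (P_free_part A)"
proof -
  interpret stable_monoid A
    using assms by unfold_locales
  show ?thesis by (rule game_monoid_PA)
qed

end
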